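(* Let $P$ be a set of $n\geq 3$ points in convex position in the plane. Then the maximum number of pairwise edge-disjoint 1-plane Hamiltonian cycles that can be packed into the complete geometric graph $K_n$ on $P$ is $\lfloor n/3\rfloor$; that is, every family of pairwise edge-disjoint 1-plane Hamiltonian cycles on $P$ has at most $\lfloor n/3\rfloor$ members, and there exists a family of $\lfloor n/3\rfloor$ pairwise edge-disjoint 1-plane Hamiltonian cycles on $P$.
   Context: A geometric graph on a finite planar point set $P$ has vertex set $P$ and its edges are straight-line segments with endpoints in $P$; the complete geometric graph $K_n$ on $P$ ($|P|=n$) contains all segments joining pairs of points of $P$. Points are in convex position if they are the vertices of a convex polygon (no three collinear). Two edges cross if they share a point that is interior to both segments. A geometric graph is 1-plane if each of its edges is crossed by at most one other edge of that graph. A 1-plane Hamiltonian cycle (1-PHC) on $P$ is a Hamiltonian cycle of $K_n$ that is 1-plane as a geometric graph. Subgraphs are edge-disjoint if they share no edge, and a packing is a set of pairwise edge-disjoint subgraphs (edges of different cycles may cross arbitrarily). *)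

theory Defs
  imports "HOL-Analysis.Analysis"
begin

text \<open>
  Edges of a geometric graph are represented by their two-element sets of endpoints; the
  corresponding segment is determined by these endpoints. A cycle is represented by its edge set.
\<close>

type_synonym point = "real^2"

text \<open>
  A convex polygon is a two-dimensional polytope. The last conjunct follows from the first one
  and is kept only to make the exclusion of collinear triples explicit.
\<close>

definition convex_position :: "point set \<Rightarrow> bool" where
  "convex_position P \<longleftrightarrow>
     (\<exists>S. polytope S \<and> aff_dim S = 2 \<and> P = {v. v extreme_point_of S}) \<and>
     (\<forall>T\<subseteq>P. card T = 3 \<longrightarrow> \<not> collinear T)"

definition complete_edges :: "'a set \<Rightarrow> 'a set set" where
  "complete_edges V = {e. e \<subseteq> V \<and> card e = 2}"

definition crosses :: "point set \<Rightarrow> point set \<Rightarrow> bool" where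
  "crosses e f \<longleftrightarrow>
     (\<exists>a b c d. e = {a, b} \<and> f = {c, d} \<and> open_segment a b \<inter> open_segment c d \<noteq> {})"

definition one_plane :: "point set set \<Rightarrow> bool" where
  "one_plane E \<longleftrightarrow> (\<forall>e\<in>E. \<exists>\<^sub>\<le>\<^sub>1 f. f \<in> E \<and> f \<noteq> e \<and> crosses e f)"

definition cycle_edges :: "'a list \<Rightarrow> 'a set set" where
  "cycle_edges xs = {{xs ! i, xs ! (Suc i mod length xs)} | i. i < length xs}"

definition hamiltonian_cycle :: "'a set \<Rightarrow> 'a set set \<Rightarrow> 'a set set \<Rightarrow> bool" where
  "hamiltonian_cycle V E C \<longleftrightarrow>
     C \<subseteq> E \<and>
     (\<exists>xs. distinct xs \<and> 3 \<le> length xs \<and> set xs = V \<and> C = cycle_edges xs)"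

definition one_PHC :: "point set \<Rightarrow> point set set \<Rightarrow> bool" where
  "one_PHC P C \<longleftrightarrow> hamiltonian_cycle P (complete_edges P) C \<and> one_plane C"

text \<open>
  Cycles are nonempty edge sets, so edge-disjoint cycles are distinct and a packing can be taken
  as a set of cycles rather than an indexed family.
\<close>

definition one_PHC_packing :: "point set \<Rightarrow> point set set set \<Rightarrow> bool" where
  "one_PHC_packing P F \<longleftrightarrow> (\<forall>C\<in>F. one_PHC P C) \<and> disjoint F"

end

theory Submission
  imports Defs
begin

text \<open>
  Number the points cyclically along the polygon. Two chords cross iff their endpoints interleave,
  so everything becomes a statement about intervals of indices.

  Upper bound. A Hamiltonian cycle has degree two everywhere and passes every cut at least twice.
  Counting edges out of arcs of the polygon with these two facts, one sees that every diagonal of a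
  1-plane Hamiltonian cycle is crossed, and that the diagonal crossing \<open>{i, j}\<close> is \<open>{i + 1, j + 1}\<close>
  or \<open>{i - 1, j - 1}\<close> (\<open>crossing_pair_parallel\<close>). Such a pair is a gate between two
  complementary arcs. Behind a gate there is always an ear, that is, an arc of \<open>m\<close> points along which
  the cycle runs on the boundary and which it leaves through a gate (\<open>gate_contains_ear\<close>). A cycle
  other than the polygon itself has two ears, one on either side of some gate. In a packing, ears use
  disjoint sets of polygon edges. An ear with \<open>m \<ge> 3\<close> points uses at least two of them; an ear with
  two points uses only one, but it also contains the two chords that cut off a single endpoint of
  this polygon edge, so two such ears are never on adjacent polygon edges. Hence an ear accounts for
  one and a half polygon edges on average and there are at most \<open>2 n / 3\<close> ears, that is,
  at most \<open>n / 3\<close> cycles. The average is made exact by letting each ear claim three half edges (\<open>ear_tokens_disjoint\<close>).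

  Lower bound. For each residue \<open>s\<close> modulo \<open>n\<close>, the chords \<open>{x, y}\<close> with \<open>x + y\<close> congruent to \<open>s - 1\<close>
  or \<open>s + 1\<close> form a ladder of crossing pairs across the polygon. Closed up by at most two polygon
  edges with \<open>x + y\<close> congruent to \<open>s\<close>, they form a 1-plane Hamiltonian cycle
  (\<open>zigzag_cycle_exists\<close>). The cycles with \<open>s\<close> in \<open>{0, 3, 6, \<dots>}\<close> use disjoint sets of sums.
\<close>

section \<open>Orientation of triples in the plane\<close>

text \<open>
  Twice the signed area of the triangle \<open>a b c\<close>: positive iff the triple turns counterclockwise.
\<close>

definition orient :: "point \<Rightarrow> point \<Rightarrow> point \<Rightarrow> real" where
  "orient a b c = (b$1 - a$1) * (c$2 - a$2) - (b$2 - a$2) * (c$1 - a$1)"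

lemma orient_rotate: "orient b c a = orient a b c"
  by (simp add: orient_def algebra_simps)

lemma orient_swap: "orient a c b = - orient a b c"
  by (simp add: orient_def algebra_simps)

lemma orient_same [simp]: "orient a b a = 0" "orient a b b = 0" "orient a a b = 0"
  by (simp_all add: orient_def)

lemma orient_affine:
  "orient a b ((1 - t) *\<^sub>R c + t *\<^sub>R d) = (1 - t) * orient a b c + t * orient a b d"
  by (simp add: orient_def algebra_simps)

lemma orient_zero_imp_collinear:
  assumes "orient a b c = 0"
  shows "collinear {a, b, c}"
proof (cases "a = b")
  case True
  then show ?thesis by simp
next
  case False
  define w where "w = b - a"
  have cross: "w$1 * (c - a)$2 = w$2 * (c - a)$1"
    using assms by (simp add: orient_def w_def)
  have "w \<noteq> 0" using False by (simp add: w_def)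
  then have "w$1 \<noteq> 0 \<or> w$2 \<noteq> 0"
    by (auto simp: vec_eq_iff forall_2)
  then obtain t where t: "c - a = t *\<^sub>R w"
  proof
    assume w: "w$1 \<noteq> 0"
    have "c - a = ((c - a)$1 / w$1) *\<^sub>R w"
      using w cross by (simp add: vec_eq_iff forall_2 field_simps)
    then show thesis using that by blast
  next
    assume w: "w$2 \<noteq> 0"
    have "c - a = ((c - a)$2 / w$2) *\<^sub>R w"
      using w cross by (simp add: vec_eq_iff forall_2 field_simps)
    then show thesis using that by blast
  qed
  then have "c = t *\<^sub>R b + (1 - t) *\<^sub>R a"
    by (simp add: w_def algebra_simps)
  then have "collinear {b, c, a}"
    unfolding collinear_3_expand by blast
  then show ?thesis by (simp add: insert_commute)
qed

text \<open>
  The diagonals of a convex quadrilateral \<open>a c b d\<close> meet. Their common point divides each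
  diagonal in the ratio of the areas of the two triangles into which the other diagonal splits
  the quadrilateral.
\<close>

lemma open_segments_meet:
  assumes "orient a c b > 0" "orient a b d > 0" "orient c b d > 0" "orient a c d > 0"
  shows "open_segment a b \<inter> open_segment c d \<noteq> {}"
proof -
  define W where "W = orient a b d + orient a c b"
  have W: "W > 0" using assms by (simp add: W_def)
  have W': "W = orient a c d + orient c b d"
    by (simp add: W_def orient_def algebra_simps)
  define s where "s = orient a c d / W"
  define t where "t = orient a c b / W"
  have s: "0 < s" "s < 1" using assms W' W by (simp_all add: s_def)
  have t: "0 < t" "t < 1" using assms W W_def by (simp_all add: t_def)
  have "W *\<^sub>R ((1 - s) *\<^sub>R a + s *\<^sub>R b) = W *\<^sub>R ((1 - t) *\<^sub>R c + t *\<^sub>R d)"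
  proof -
    have "W * (1 - s) = orient c b d" "W * s = orient a c d"
      "W * (1 - t) = orient a b d" "W * t = orient a c b"
      using W W' W_def by (simp_all add: s_def t_def right_diff_distrib)
    then show ?thesis
      by (simp add: scaleR_add_right) (simp add: vec_eq_iff forall_2 orient_def algebra_simps)
  qed
  then have eq: "(1 - s) *\<^sub>R a + s *\<^sub>R b = (1 - t) *\<^sub>R c + t *\<^sub>R d"
    using W by simp
  have "a \<noteq> b" "c \<noteq> d" using assms by auto
  then have "(1 - s) *\<^sub>R a + s *\<^sub>R b \<in> open_segment a b"
    "(1 - t) *\<^sub>R c + t *\<^sub>R d \<in> open_segment c d"
    using s t unfolding in_segment by blast+
  then show ?thesis using eq by auto
qed

text \<open>
  The affine function \<open>orient a b\<close> vanishes on the segment \<open>a b\<close> and is negative on the whole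
  open segment \<open>c d\<close>.
\<close>

lemma open_segments_disjoint:
  assumes "orient a b c \<le> 0" "orient a b d \<le> 0" "orient a b c < 0 \<or> orient a b d < 0"
  shows "open_segment a b \<inter> open_segment c d = {}"
proof (rule ccontr)
  assume "\<not> ?thesis"
  then obtain z where z: "z \<in> open_segment a b" "z \<in> open_segment c d" by blast
  obtain s where s: "z = (1 - s) *\<^sub>R a + s *\<^sub>R b" using z(1) unfolding in_segment by blast
  obtain t where t: "z = (1 - t) *\<^sub>R c + t *\<^sub>R d" "0 < t" "t < 1"
    using z(2) unfolding in_segment by blast
  have "orient a b z = 0" unfolding s orient_affine by simp
  moreover have "orient a b z < 0"
  proof -
    have "(1 - t) * orient a b c \<le> 0" "t * orient a b d \<le> 0"
      using t assms by (simp_all add: mult_nonneg_nonpos)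
    moreover have "(1 - t) * orient a b c < 0 \<or> t * orient a b d < 0"
      using t assms(3) by (auto simp: mult_pos_neg)
    ultimately show ?thesis unfolding t(1) orient_affine by linarith
  qed
  ultimately show False by simp
qed

text \<open>
  If \<open>b\<close> lies in the angle at \<open>o'\<close> spanned by \<open>a\<close> and \<open>d\<close> but the path \<open>a b d\<close> turns clockwise, then
  \<open>b\<close> has not passed the line \<open>a d\<close>. The barycentric coordinates of \<open>b\<close> are ratios of areas.
\<close>

lemma in_triangle_if_reflex:
  assumes "orient o' a b > 0" "orient o' b d > 0" "orient a b d < 0"
  shows "b \<in> convex hull {o', a, d}"
proof -
  define W where "W = orient o' a b + orient o' b d - orient a b d"
  have W: "W > 0" using assms by (simp add: W_def)
  define u v w where "u = - orient a b d / W" and "v = orient o' b d / W" and "w = orient o' a b / W"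
  have nn: "0 \<le> u" "0 \<le> v" "0 \<le> w" using assms W by (simp_all add: u_def v_def w_def divide_le_0_iff)
  have "u + v + w = (orient o' a b + orient o' b d - orient a b d) / W"
    unfolding u_def v_def w_def by (simp add: diff_divide_distrib add_divide_distrib)
  then have sum: "u + v + w = 1" using W by (simp flip: W_def)
  have "W *\<^sub>R b = W *\<^sub>R (u *\<^sub>R o' + v *\<^sub>R a + w *\<^sub>R d)"
  proof -
    have "W * u = - orient a b d" "W * v = orient o' b d" "W * w = orient o' a b"
      using W by (simp_all add: u_def v_def w_def)
    then show ?thesis
      by (simp add: scaleR_add_right)
        (simp add: W_def vec_eq_iff forall_2 orient_def algebra_simps)
  qed
  then have "b = u *\<^sub>R o' + v *\<^sub>R a + w *\<^sub>R d" using W by simp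
  then show ?thesis unfolding convex_hull_3 using nn sum by blast
qed

section \<open>Cyclic numbering of points in convex position\<close>

lemma convex_position_not_in_hull:
  assumes "convex_position P" "v \<in> P"
  shows "v \<notin> convex hull (P - {v})"
proof -
  obtain S where S: "polytope S" "P = {v. v extreme_point_of S}"
    using assms(1) by (auto simp: convex_position_def)
  have ext: "v extreme_point_of S" using assms(2) S(2) by simp
  have "convex (S - {v})"
    using ext polytope_imp_convex[OF S(1)] extreme_point_of_stillconvex by blast
  moreover have "P - {v} \<subseteq> S - {v}" using S(2) by (auto simp: extreme_point_of_def)
  ultimately have "convex hull (P - {v}) \<subseteq> S - {v}" by (rule hull_minimal[rotated])
  then show ?thesis by blast
qed

lemma convex_position_orient_nonzero:
  assumes "convex_position P" "a \<in> P" "b \<in> P" "c \<in> P" "a \<noteq> b" "a \<noteq> c" "b \<noteq> c"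
  shows "orient a b c \<noteq> 0"
proof
  assume "orient a b c = 0"
  then have "collinear {a, b, c}" by (rule orient_zero_imp_collinear)
  moreover have "card {a, b, c} = 3" "{a, b, c} \<subseteq> P" using assms by auto
  ultimately show False using assms(1) unfolding convex_position_def by blast
qed

text \<open>
  One point \<open>o'\<close> can be strictly separated from the others, hence sees them within an open half
  plane, where sorting by slope is the same as sorting by counterclockwise angle. Triples through
  \<open>o'\<close> are then positively oriented by construction; any other triple with the wrong orientation
  would put its middle point into a triangle of other points.
\<close>

lemma ccw_numbering_exists:
  assumes fin: "finite P" and card: "card P = n" and n: "n \<ge> 3" and conv: "convex_position P"
  obtains p :: "nat \<Rightarrow> point" where "bij_betw p {..<n} P"
    "\<And>i j k. i < j \<Longrightarrow> j < k \<Longrightarrow> k < n \<Longrightarrow> orient (p i) (p j) (p k) > 0"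
proof -
  obtain o' where o': "o' \<in> P" using card n by fastforce
  define R where "R = P - {o'}"
  have finR: "finite R" and cardR: "card R = n - 1"
    using fin card o' by (auto simp: R_def)
  have "o' \<notin> convex hull R"
    using convex_position_not_in_hull[OF conv o'] by (simp add: R_def)
  moreover have "closed (convex hull R)"
    using finR by (simp add: finite_imp_compact_convex_hull compact_imp_closed)
  ultimately obtain u b where "u \<bullet> o' < b" "\<And>x. x \<in> convex hull R \<Longrightarrow> u \<bullet> x > b"
    using separating_hyperplane_closed_point[of "convex hull R" o'] by auto
  then have pos: "u \<bullet> (x - o') > 0" if "x \<in> R" for x
    using that hull_subset[of R convex] by (fastforce simp: inner_diff_right)
  \<comment> \<open>Slope of \<open>x\<close> as seen from \<open>o'\<close>, in the frame whose first axis is \<open>u\<close>.\<close>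
  define key where
    "key x = (u$1 * (x - o')$2 - u$2 * (x - o')$1) / (u \<bullet> (x - o'))" for x
  have u_ne: "u \<bullet> u > 0"
  proof -
    have "R \<noteq> {}" using cardR n by auto
    then obtain x where "x \<in> R" by blast
    then have "u \<noteq> 0" using pos[of x] by auto
    then show ?thesis by simp
  qed
  have key_orient: "(u \<bullet> u) * orient o' x y
      = (u \<bullet> (x - o')) * (u \<bullet> (y - o')) * (key y - key x)" if "x \<in> R" "y \<in> R" for x y
  proof -
    have "(u \<bullet> (x - o')) * (u \<bullet> (y - o')) * (key y - key x)
      = (u \<bullet> (x - o')) * (u$1 * (y - o')$2 - u$2 * (y - o')$1)
        - (u \<bullet> (y - o')) * (u$1 * (x - o')$2 - u$2 * (x - o')$1)"
      using pos[OF that(1)] pos[OF that(2)] by (simp add: key_def field_simps)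
    also have "\<dots> = (u \<bullet> u) * orient o' x y"
      by (simp add: inner_vec_def sum_2 orient_def algebra_simps)
    finally show ?thesis by simp
  qed
  have inj: "inj_on key R"
  proof (rule inj_onI, rule ccontr)
    fix x y assume xy: "x \<in> R" "y \<in> R" "key x = key y" "x \<noteq> y"
    then have "orient o' x y = 0" using key_orient[OF xy(1,2)] u_ne by simp
    then show False
      using convex_position_orient_nonzero[OF conv o', of x y] xy by (auto simp: R_def)
  qed
  define ks where "ks = sorted_list_of_set (key ` R)"
  have ks: "sorted_wrt (<) ks" "set ks = key ` R" "length ks = n - 1"
    using finR inj cardR by (simp_all add: ks_def card_image)
  define p where "p i = (if i = 0 then o' else the_inv_into R key (ks ! (i - 1)))" for i
  have pR: "p i \<in> R \<and> key (p i) = ks ! (i - 1)" if "0 < i" "i < n" for i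
  proof -
    have "ks ! (i - 1) \<in> key ` R" using that ks by (metis Suc_diff_1 diff_less_mono less_eq_Suc_le nth_mem One_nat_def)
    then show ?thesis using that inj
      by (auto simp: p_def f_the_inv_into_f the_inv_into_f_f)
  qed
  have key_mono: "key (p i) < key (p j)" if "0 < i" "i < j" "j < n" for i j
  proof -
    have "ks ! (i - 1) < ks ! (j - 1)"
      using ks that by (intro sorted_wrt_nth_less[of "(<)"]) auto
    then show ?thesis using pR that by simp
  qed
  have orient0: "orient o' (p i) (p j) > 0" if "0 < i" "i < j" "j < n" for i j
  proof -
    have R: "p i \<in> R" "p j \<in> R" using pR that by auto
    have "(u \<bullet> u) * orient o' (p i) (p j) > 0"
      unfolding key_orient[OF R] using pos[OF R(1)] pos[OF R(2)] key_mono[OF that] by simp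
    then show ?thesis using u_ne by (simp add: zero_less_mult_iff)
  qed
  have p0: "p 0 = o'" by (simp add: p_def)
  have inj_p: "inj_on p {..<n}"
  proof (rule linorder_inj_onI)
    fix i j assume ij: "i < j" "i \<in> {..<n}" "j \<in> {..<n}"
    show "p i \<noteq> p j"
    proof (cases "i = 0")
      case True
      then show ?thesis using pR[of j] ij p0 by (auto simp: R_def)
    next
      case False
      then show ?thesis using key_mono[of i j] ij by auto
    qed
  qed auto
  have p_in: "p i \<in> P" if "i < n" for i
    using pR[of i] that o' p0 by (cases "i = 0") (auto simp: R_def)
  have "p ` {..<n} = P"
    using p_in inj_p by (intro card_subset_eq fin) (auto simp: card_image card)
  then have bij: "bij_betw p {..<n} P" using inj_p by (simp add: bij_betw_def)
  moreover have "orient (p i) (p j) (p k) > 0" if ijk: "i < j" "j < k" "k < n" for i j k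
  proof (cases "i = 0")
    case True
    then show ?thesis using orient0[of j k] that p0 by simp
  next
    case False
    have ne: "p i \<noteq> p j" "p i \<noteq> p k" "p j \<noteq> p k" "o' \<noteq> p j"
      using key_mono[of i j] key_mono[of i k] key_mono[of j k] False ijk pR[of j]
      by (auto simp: R_def)
    have nz: "orient (p i) (p j) (p k) \<noteq> 0"
      using ijk ne p_in by (intro convex_position_orient_nonzero[OF conv]) auto
    have "\<not> orient (p i) (p j) (p k) < 0"
    proof
      assume "orient (p i) (p j) (p k) < 0"
      then have "p j \<in> convex hull {o', p i, p k}"
        using False ijk by (intro in_triangle_if_reflex orient0) auto
      moreover have "{o', p i, p k} \<subseteq> P - {p j}" using ne p_in ijk o' by auto
      ultimately have "p j \<in> convex hull (P - {p j})" using hull_mono by blast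
      then show False using convex_position_not_in_hull[OF conv] p_in ijk by simp
    qed
    then show ?thesis using nz by linarith
  qed
  ultimately show thesis using that by blast
qed

text \<open>
  The points are numbered by all integers, with period \<open>n\<close>. Arcs of the polygon then become
  integer intervals and no case distinction is needed where an arc passes index \<open>0\<close>; the
  orientation condition covers every triple within one period, so it is invariant under rotation.
\<close>

locale convex_polygon =
  fixes P :: "point set" and n :: nat and q :: "int \<Rightarrow> point"
  assumes n_ge_3: "3 \<le> n"
    and range_q: "range q = P"
    and q_eq_iff: "q x = q y \<longleftrightarrow> x mod int n = y mod int n"
    and ccw: "x < y \<Longrightarrow> y < z \<Longrightarrow> z < x + int n \<Longrightarrow> orient (q x) (q y) (q z) > 0"

lemma convex_polygon_exists:
  assumes "finite P" "card P = n" "n \<ge> 3" "convex_position P"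
  obtains q where "convex_polygon P n q"
proof -
  obtain p where p: "bij_betw p {..<n} P"
    and ccw: "\<And>i j k. i < j \<Longrightarrow> j < k \<Longrightarrow> k < n \<Longrightarrow> orient (p i) (p j) (p k) > 0"
    using ccw_numbering_exists[OF assms] by blast
  define q where "q x = p (nat (x mod int n))" for x
  have n0: "int n > 0" using assms(3) by simp
  have idx: "nat (x mod int n) < n" for x using n0 by (simp add: nat_less_iff)
  have "convex_polygon P n q"
  proof
    show "3 \<le> n" by fact
    show "range q = P"
    proof
      show "range q \<subseteq> P" using p idx by (auto simp: q_def bij_betw_def)
      show "P \<subseteq> range q"
      proof
        fix v assume "v \<in> P"
        then obtain i where "i < n" "v = p i" using p by (auto simp: bij_betw_def)
        then have "v = q (int i)" by (simp add: q_def)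
        then show "v \<in> range q" by blast
      qed
    qed
    show "q x = q y \<longleftrightarrow> x mod int n = y mod int n" for x y
    proof
      assume "q x = q y"
      then have "nat (x mod int n) = nat (y mod int n)"
        using p idx by (auto simp: q_def bij_betw_def inj_on_def)
      then show "x mod int n = y mod int n" using n0 by (simp add: nat_eq_iff)
    qed (simp add: q_def)
    fix x y z :: int
    assume xyz: "x < y" "y < z" "z < x + int n"
    define x' y' z' where "x' = x mod int n" and "y' = x' + (y - x)" and "z' = x' + (z - x)"
    have x': "0 \<le> x'" "x' < int n" using n0 by (simp_all add: x'_def)
    have order: "x' < y'" "y' < z'" "z' < x' + int n" using xyz by (simp_all add: y'_def z'_def)
    have ym: "y mod int n = y' mod int n" and zm: "z mod int n = z' mod int n"
      by (simp_all add: x'_def y'_def z'_def mod_simps)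
    have wrap: "w mod int n = (if w < int n then w else w - int n)" if "0 \<le> w" "w < 2 * int n" for w
    proof (cases "w < int n")
      case False
      have "w mod int n = (w - int n) mod int n" by simp
      also have "\<dots> = w - int n" using that False by (intro mod_pos_pos_trivial) auto
      finally show ?thesis using False by simp
    qed (use that in simp)
    have q: "q x = p (nat x')" "q y = p (nat (if y' < int n then y' else y' - int n))"
      "q z = p (nat (if z' < int n then z' else z' - int n))"
    proof -
      have "y' mod int n = (if y' < int n then y' else y' - int n)"
        "z' mod int n = (if z' < int n then z' else z' - int n)"
        by (rule wrap; use x' order in linarith)+
      then show "q y = p (nat (if y' < int n then y' else y' - int n))"
        "q z = p (nat (if z' < int n then z' else z' - int n))"
        by (simp_all only: q_def ym zm)
    qed (simp only: q_def x'_def)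
    \<comment> \<open>Only the part of the triple that runs past the last index is renumbered, so the
      reduced triple is a rotation of an increasing one.\<close>
    consider "z' < int n" | "y' < int n" "z' \<ge> int n" | "y' \<ge> int n" by linarith
    then show "orient (q x) (q y) (q z) > 0"
    proof cases
      case 1
      then show ?thesis using x' order ccw[of "nat x'" "nat y'" "nat z'"] by (simp add: q)
    next
      case 2
      then have "orient (p (nat (z' - int n))) (p (nat x')) (p (nat y')) > 0"
        using x' order by (intro ccw) auto
      then show ?thesis using 2 by (simp add: q orient_rotate)
    next
      case 3
      then have "orient (p (nat (y' - int n))) (p (nat (z' - int n))) (p (nat x')) > 0"
        using x' order by (intro ccw) auto
      then show ?thesis using 3 order
        by (simp add: q) (metis orient_rotate)
    qed
  qed
  then show thesis using that by blast
qed

lemma crosses_sym: "crosses e f \<longleftrightarrow> crosses f e"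
  unfolding crosses_def by blast

lemma crosses_iff: "crosses {a, b} {c, d} \<longleftrightarrow> open_segment a b \<inter> open_segment c d \<noteq> {}"
proof
  assume "crosses {a, b} {c, d}"
  then obtain a' b' c' d' where *: "{a, b} = {a', b'}" "{c, d} = {c', d'}"
    "open_segment a' b' \<inter> open_segment c' d' \<noteq> {}" unfolding crosses_def by blast
  have same: "open_segment x y = open_segment x' y'" if "{x, y} = {x', y'}" for x y x' y' :: point
    using that open_segment_commute[of x y] unfolding doubleton_eq_iff by blast
  have "open_segment a b = open_segment a' b'" "open_segment c d = open_segment c' d'"
    by (rule same[OF *(1)], rule same[OF *(2)])
  then show "open_segment a b \<inter> open_segment c d \<noteq> {}" using *(3) by (simp only: not_False_eq_True)
next
  assume "open_segment a b \<inter> open_segment c d \<noteq> {}"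
  then show "crosses {a, b} {c, d}" unfolding crosses_def by blast
qed

context convex_polygon
begin

lemma q_add_n [simp]: "q (x + int n) = q x"
  by (simp add: q_eq_iff)

lemma q_in [simp]: "q x \<in> P"
  using range_q by auto

lemma q_inj:
  assumes "q x = q y" "\<bar>x - y\<bar> < int n"
  shows "x = y"
proof -
  have "int n dvd x - y" using assms(1) by (simp add: q_eq_iff mod_eq_dvd_iff)
  then show ?thesis using assms(2) dvd_imp_le_int[of "x - y" "int n"] by fastforce
qed

lemma representative:
  assumes "v \<in> P"
  obtains x where "l \<le> x" "x < l + int n" "v = q x"
proof -
  obtain y where y: "v = q y" using assms range_q by auto
  define x where "x = l + (y - l) mod int n"
  have "l \<le> x" "x < l + int n" using n_ge_3 by (simp_all add: x_def)
  moreover have "v = q x" by (simp add: y q_eq_iff x_def mod_simps)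
  ultimately show thesis using that by blast
qed

lemma finite_P: "finite P" and card_P: "card P = n"
proof -
  have eq: "P = q ` {0..<int n}"
  proof
    show "P \<subseteq> q ` {0..<int n}"
    proof
      fix v assume "v \<in> P"
      then obtain x where "0 \<le> x" "x < 0 + int n" "v = q x" using representative by metis
      then show "v \<in> q ` {0..<int n}" by auto
    qed
  qed auto
  show "finite P" unfolding eq by simp
  have "inj_on q {0..<int n}" by (rule inj_onI) (rule q_inj, auto)
  then show "card P = n" unfolding eq by (simp add: card_image)
qed

text \<open>
  The next two lemmas are all that the rest of the proof uses from the geometry: two chords cross
  iff their endpoints interleave on the polygon.
\<close>

lemma crosses_if_interleaved:
  assumes "a < c" "c < b" "b < d" "d < a + int n"
  shows "crosses {q a, q b} {q c, q d}"
  unfolding crosses_iff using assms by (intro open_segments_meet ccw) auto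

lemma not_crosses_if_nested:
  assumes "a < b" "b < a + int n" "a \<le> c" "c < d" "d \<le> b" "a < c \<or> d < b"
  shows "\<not> crosses {q a, q b} {q c, q d}"
proof -
  have neg: "orient (q a) (q b) (q x) < 0" if "a < x" "x < b" for x
    using ccw[of a x b] that assms orient_swap[of "q a" "q x" "q b"] by simp
  have "orient (q a) (q b) (q x) \<le> 0" if "a \<le> x" "x \<le> b" for x
    using neg[of x] that by (cases "x = a \<or> x = b") auto
  moreover have "orient (q a) (q b) (q c) < 0 \<or> orient (q a) (q b) (q d) < 0"
    using neg assms by (cases "a < c") auto
  ultimately show ?thesis
    unfolding crosses_iff using assms by (subst open_segments_disjoint) auto
qed

end

section \<open>Degrees and cuts of Hamiltonian cycles\<close>

text \<open>
  Going round the cycle forever removes the special role of the closing edge.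
\<close>

lemma hamiltonian_cycle_cyclic_enumeration:
  assumes "hamiltonian_cycle V E C"
  obtains N :: nat and f :: "nat \<Rightarrow> 'a" where "3 \<le> N" "range f = V"
    "\<forall>i j. f i = f j \<longleftrightarrow> i mod N = j mod N"
    "C = range (\<lambda>i. {f i, f (Suc i)})"
proof -
  obtain xs where xs: "distinct xs" "3 \<le> length xs" "set xs = V" "C = cycle_edges xs"
    using assms unfolding hamiltonian_cycle_def by blast
  define N where "N = length xs"
  define f where "f i = xs ! (i mod N)" for i
  have N: "3 \<le> N" "0 < N" using xs by (auto simp: N_def)
  have "range f = V"
  proof
    show "range f \<subseteq> V" using N xs(3) by (auto simp: f_def N_def)
    show "V \<subseteq> range f"
    proof
      fix v assume "v \<in> V"
      then obtain i where "i < N" "v = xs ! i" using xs(3) by (auto simp: in_set_conv_nth N_def)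
      then have "v = f i" by (simp add: f_def)
      then show "v \<in> range f" by blast
    qed
  qed
  moreover have "\<forall>i j. f i = f j \<longleftrightarrow> i mod N = j mod N"
    using xs(1) N by (simp add: f_def N_def nth_eq_iff_index_eq)
  moreover have "C = range (\<lambda>i. {f i, f (Suc i)})"
  proof
    show "C \<subseteq> range (\<lambda>i. {f i, f (Suc i)})"
    proof
      fix e assume "e \<in> C"
      then obtain i where "i < N" "e = {xs ! i, xs ! (Suc i mod N)}"
        unfolding xs(4) cycle_edges_def N_def by blast
      then have "e = {f i, f (Suc i)}" by (simp add: f_def)
      then show "e \<in> range (\<lambda>i. {f i, f (Suc i)})" by blast
    qed
    show "range (\<lambda>i. {f i, f (Suc i)}) \<subseteq> C"
    proof
      fix e assume "e \<in> range (\<lambda>i. {f i, f (Suc i)})"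
      then obtain i where "e = {f i, f (Suc i)}" by blast
      then have "e = {xs ! (i mod N), xs ! (Suc (i mod N) mod N)}" "i mod N < length xs"
        using N(2) by (simp_all add: f_def mod_Suc_eq flip: N_def)
      then show "e \<in> C" unfolding xs(4) cycle_edges_def N_def by blast
    qed
  qed
  ultimately show thesis using that N(1) by blast
qed

lemma hamiltonian_cycle_degree_le_2:
  assumes "hamiltonian_cycle V E C" "{v, x} \<in> C" "{v, y} \<in> C" "{v, z} \<in> C"
  shows "x = y \<or> x = z \<or> y = z"
proof -
  obtain N f where f: "3 \<le> N" "range f = V" "\<forall>i j. f i = f j \<longleftrightarrow> i mod N = j mod N"
    "C = range (\<lambda>i. {f i, f (Suc i)})"
    by (rule hamiltonian_cycle_cyclic_enumeration[OF assms(1)])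
  obtain k where k: "v = f k" using assms(2) f(4) by (auto simp: doubleton_eq_iff)
  have nbr: "w = f (Suc k) \<or> w = f (k + (N - 1))" if w: "{v, w} \<in> C" for w
  proof -
    obtain i where "{f k, w} = {f i, f (Suc i)}" using w f(4) k by auto
    then consider "f k = f i" "w = f (Suc i)" | "f k = f (Suc i)" "w = f i"
      by (auto simp: doubleton_eq_iff)
    then show ?thesis
    proof cases
      case 1
      then have "f (Suc k) = f (Suc i)" using f(3) by (metis mod_Suc_eq)
      then show ?thesis using 1 by simp
    next
      case 2
      then have "(k + (N - 1)) mod N = (Suc i + (N - 1)) mod N" using f(3) mod_add_cong by blast
      also have "Suc i + (N - 1) = i + N" using f(1) by simp
      finally have "f (k + (N - 1)) = f i" using f(3) by simp
      then show ?thesis using 2 by simp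
    qed
  qed
  show ?thesis using nbr[OF assms(2)] nbr[OF assms(3)] nbr[OF assms(4)] by auto
qed

text \<open>
  Walking round the cycle, one leaves \<open>S\<close> and one enters \<open>S\<close>; with at least three vertices these
  are two different edges.
\<close>

lemma hamiltonian_cycle_cut:
  assumes "hamiltonian_cycle V E C" "S \<subseteq> V" "S \<noteq> {}" "S \<noteq> V"
  obtains x y x' y' where "x \<in> S" "y \<in> V - S" "{x, y} \<in> C"
    "x' \<in> S" "y' \<in> V - S" "{x', y'} \<in> C" "{x, y} \<noteq> {x', y'}"
proof -
  obtain N f where f: "3 \<le> N" "range f = V" "\<forall>i j. f i = f j \<longleftrightarrow> i mod N = j mod N"
    "C = range (\<lambda>i. {f i, f (Suc i)})"
    by (rule hamiltonian_cycle_cyclic_enumeration[OF assms(1)])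
  have step: "\<exists>k. f k \<in> A \<and> f (Suc k) \<notin> A" if A: "a \<in> A" "b \<in> V - A" "a \<in> V" for A a b
  proof (rule ccontr)
    assume "\<not> ?thesis"
    then have closed: "\<And>k. f k \<in> A \<Longrightarrow> f (Suc k) \<in> A" by blast
    obtain i where i: "a = f i" using A f(2) by auto
    obtain j where j: "b = f j" using A f(2) by auto
    have "f (i + m) \<in> A" for m
      by (induction m) (use A i closed in auto)
    from this[of "j + (N - 1) * i"] have "f (i + (j + (N - 1) * i)) \<in> A" .
    moreover have "i + (j + (N - 1) * i) = j + N * i" using f(1) by (cases N) auto
    then have "(i + (j + (N - 1) * i)) mod N = j mod N" by (simp only: mod_mult_self2)
    then have "f (i + (j + (N - 1) * i)) = f j" using f(3) by blast
    ultimately show False using A j by simp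
  qed
  obtain a where a: "a \<in> S" using assms by blast
  obtain b where b: "b \<in> V - S" using assms by blast
  obtain k where k: "f k \<in> S" "f (Suc k) \<notin> S" using step[of a S b] a b assms by blast
  obtain j where j: "f j \<notin> S" "f (Suc j) \<in> S" using step[of b "V - S" a] a b assms f(2) by blast
  have "{f k, f (Suc k)} \<noteq> {f (Suc j), f j}"
  proof
    assume "{f k, f (Suc k)} = {f (Suc j), f j}"
    then have "f k = f (Suc j)" "f (Suc k) = f j" using k j by (auto simp: doubleton_eq_iff)
    then have "(Suc (Suc j)) mod N = j mod N" using f(3) by (metis mod_Suc_eq)
    then have "N dvd 2" using mod_eq_dvd_iff_nat[of j "Suc (Suc j)" N] by simp
    then show False using f(1) dvd_imp_le[of N 2] by simp
  qed
  then show thesis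
    using that[of "f k" "f (Suc k)" "f (Suc j)" "f j"] k j f(2,4) by (auto simp: insert_commute)
qed

text \<open>
  A set \<open>T\<close> whose only exits are the vertices \<open>a\<close> and \<open>b\<close>, each of which has already spent one of
  its two edges outside \<open>T\<close>, needs two edges to its complement and so must use the remaining edge
  of both. This one counting argument replaces all reasoning about paths.
\<close>

lemma hamiltonian_cycle_escape:
  assumes ham: "hamiltonian_cycle V E C" and T: "T \<subseteq> V" "T \<noteq> {}" "a \<notin> T" "b \<notin> T" "a \<in> V"
    and a: "{a, a0} \<in> C" "a0 \<notin> T" and b: "{b, b0} \<in> C" "b0 \<notin> T"
    and leave: "\<And>x y. x \<in> T \<Longrightarrow> y \<in> V - T \<Longrightarrow> {x, y} \<in> C \<Longrightarrow> y = a \<or> y = b"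
  shows "\<exists>x\<in>T. \<exists>y\<in>T. {a, x} \<in> C \<and> {b, y} \<in> C"
proof -
  have "T \<noteq> V" using T by blast
  then obtain x y x' y' where xy: "x \<in> T" "y \<in> V - T" "{x, y} \<in> C"
    "x' \<in> T" "y' \<in> V - T" "{x', y'} \<in> C" "{x, y} \<noteq> {x', y'}"
    using hamiltonian_cycle_cut[OF ham T(1,2)] by metis
  have once: "x = x'" if "{c, c0} \<in> C" "c0 \<notin> T" "y = c" "y' = c" for c c0
    using hamiltonian_cycle_degree_le_2[OF ham, of c c0 x x'] that xy by (auto simp: insert_commute)
  have "y \<noteq> y'"
    using once[OF a] once[OF b] leave[OF xy(1-3)] leave[OF xy(4-6)] xy(7) by auto
  then have "y = a \<and> y' = b \<or> y = b \<and> y' = a"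
    using leave[OF xy(1-3)] leave[OF xy(4-6)] by auto
  then show ?thesis using xy by (auto simp: insert_commute)
qed

section \<open>Crossing pairs in a 1-plane Hamiltonian cycle\<close>

locale one_plane_cycle = convex_polygon +
  fixes C :: "point set set"
  assumes PHC: "one_PHC P C"
begin

lemma ham: "hamiltonian_cycle P (complete_edges P) C"
  using PHC by (simp add: one_PHC_def)

lemmas degree_le_2 = hamiltonian_cycle_degree_le_2[OF ham]

lemma edge_subset: "{x, y} \<in> C \<Longrightarrow> x \<in> P \<and> y \<in> P \<and> x \<noteq> y"
  using ham unfolding hamiltonian_cycle_def complete_edges_def by fastforce

lemma crossing_unique:
  assumes "e \<in> C" "f \<in> C" "g \<in> C" "f \<noteq> e" "g \<noteq> e" "crosses e f" "crosses e g"
  shows "f = g"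
  using PHC assms unfolding one_PHC_def one_plane_def Uniq_def by blast

lemma two_neighbours:
  obtains x y where "x \<noteq> y" "{q a, x} \<in> C" "{q a, y} \<in> C"
proof -
  have "{q a} \<noteq> P"
  proof
    assume "{q a} = P"
    then have "card P = 1" by auto
    then show False using card_P n_ge_3 by simp
  qed
  moreover have "{q a} \<subseteq> P" by simp
  ultimately obtain x y x' y' where "x \<in> {q a}" "y \<in> P - {q a}" "{x, y} \<in> C"
    "x' \<in> {q a}" "y' \<in> P - {q a}" "{x', y'} \<in> C" "{x, y} \<noteq> {x', y'}"
    using hamiltonian_cycle_cut[OF ham, of "{q a}"] by (metis insert_not_empty)
  then show thesis using that[of y y'] by auto
qed

text \<open>
  Four endpoints of two crossing edges cut the polygon into four arcs. An edge leaving the open arc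
  between \<open>q a\<close> and \<open>q c\<close>, unless it ends at one of these two corners, crosses one of the two given
  edges, each of which already has its only crossing. So the corners are the only exits.
\<close>

lemma corner_arc:
  assumes order: "a < c" "c < b" "b < d" "d < a + int n"
    and e: "{q a, q b} \<in> C" and f: "{q c, q d} \<in> C"
    and nonempty: "a + 1 < c"
  shows "\<exists>x\<in>{a<..<c}. \<exists>y\<in>{a<..<c}. {q a, q x} \<in> C \<and> {q c, q y} \<in> C"
proof -
  define T where "T = q ` {a<..<c}"
  have notin: "q x \<notin> T" if "c \<le> x" "x \<le> a + int n" for x
  proof
    assume "q x \<in> T"
    then obtain y where "a < y" "y < c" "q x = q y" by (auto simp: T_def)
    then show False using q_inj[of x y] that order by auto
  qed
  have "a + 1 \<in> {a<..<c}" using nonempty by simp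
  then have "T \<noteq> {}" unfolding T_def by blast
  moreover have "q a \<notin> T" using notin[of "a + int n"] order by simp
  moreover have "z = q a \<or> z = q c" if edge: "x \<in> T" "z \<in> P - T" "{x, z} \<in> C" for x z
  proof (rule ccontr)
    assume no: "\<not> ?thesis"
    obtain y where y: "x = q y" "a < y" "y < c" using edge by (auto simp: T_def)
    obtain w where w: "a \<le> w" "w < a + int n" "z = q w"
      using representative[of z a] edge by auto
    have "\<not> (a < w \<and> w < c)" using edge w by (auto simp: T_def)
    then have w': "c < w" using no w order(1) by (metis linorder_neqE_linordered_idom order_le_less)
    have "crosses {q a, q b} {q c, q d}" using order by (rule crosses_if_interleaved)
    moreover have "{x, z} \<noteq> {q a, q b}" "{x, z} \<noteq> {q c, q d}"
    proof -
      have "q b \<notin> T" "q d \<notin> T" "q c \<notin> T" using notin order by auto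
      then show "{x, z} \<noteq> {q a, q b}" "{x, z} \<noteq> {q c, q d}"
        using edge \<open>q a \<notin> T\<close> by (auto simp: doubleton_eq_iff)
    qed
    moreover have "{q a, q b} \<noteq> {q c, q d}"
      using q_inj[of a c] q_inj[of a d] order by (auto simp: doubleton_eq_iff)
    \<comment> \<open>The edge from \<open>y\<close> to \<open>w\<close> crosses \<open>{q c, q d}\<close> if \<open>w\<close> is not beyond \<open>b\<close>, and
      \<open>{q a, q b}\<close> otherwise.\<close>
    moreover have "crosses {q a, q b} {x, z} \<or> crosses {q c, q d} {x, z}"
    proof (cases "w \<le> b")
      case True
      then have "crosses {q y, q w} {q c, q d}"
        using y w w' order by (intro crosses_if_interleaved) auto
      then show ?thesis using y w crosses_sym by simp
    next
      case False
      then have "crosses {q a, q b} {q y, q w}"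
        using y w w' order by (intro crosses_if_interleaved) auto
      then show ?thesis using y w by simp
    qed
    ultimately show False
      using crossing_unique[OF e f edge(3)] crossing_unique[OF f e edge(3)] crosses_sym by metis
  qed
  ultimately have "\<exists>x\<in>T. \<exists>y\<in>T. {q a, x} \<in> C \<and> {q c, y} \<in> C"
    using order notin e f
    by (intro hamiltonian_cycle_escape[OF ham, of T "q a" "q c" "q b" "q d"]) (auto simp: T_def)
  then show ?thesis by (auto simp: T_def)
qed

text \<open>
  If both arcs at the corner \<open>q c\<close> were nonempty, each would contain a neighbour of \<open>q c\<close>, in addition
  to \<open>q d\<close>.
\<close>

lemma adjacent_arcs_not_both_nonempty:
  assumes order: "a < c" "c < b" "b < d" "d < a + int n"
    and e: "{q a, q b} \<in> C" and f: "{q c, q d} \<in> C"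
  shows "c = a + 1 \<or> b = c + 1"
proof (rule ccontr)
  assume "\<not> ?thesis"
  then have ne: "a + 1 < c" "c + 1 < b" using order by auto
  obtain y where y: "a < y" "y < c" "{q c, q y} \<in> C"
    using corner_arc[OF order e f ne(1)] by auto
  have "{q b, q (a + int n)} \<in> C" using e by (simp add: insert_commute)
  then obtain x where x: "c < x" "x < b" "{q c, q x} \<in> C"
    using corner_arc[of c b d "a + int n"] order f ne(2) by auto
  have "q x = q y \<or> q x = q d \<or> q y = q d"
    using degree_le_2[OF x(3) y(3) f] .
  then show False
    using q_inj[of x y] q_inj[of x d] q_inj[of y d] x y order by auto
qed

text \<open>
  Of any two cyclically adjacent arcs one is empty, hence two opposite arcs are empty: crossing
  edges are translates of each other by one step along the polygon.
\<close>

lemma crossing_pair_parallel: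
  assumes order: "a < c" "c < b" "b < d" "d < a + int n"
    and e: "{q a, q b} \<in> C" and f: "{q c, q d} \<in> C"
  shows "c = a + 1 \<and> d = b + 1 \<or> c = b - 1 \<and> d = a + int n - 1"
proof -
  have e': "{q b, q (a + int n)} \<in> C" and f': "{q d, q (c + int n)} \<in> C"
    using e f by (simp_all add: insert_commute)
  have e'': "{q (a + int n), q (b + int n)} \<in> C" using e by simp
  have "c = a + 1 \<or> b = c + 1"
    by (rule adjacent_arcs_not_both_nonempty) fact+
  moreover have "b = c + 1 \<or> d = b + 1"
    using adjacent_arcs_not_both_nonempty[of c b d "a + int n"] order f e' by auto
  moreover have "d = b + 1 \<or> a + int n = d + 1"
    using adjacent_arcs_not_both_nonempty[of b d "a + int n" "c + int n"] order f' e' by auto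
  moreover have "a + int n = d + 1 \<or> c = a + 1"
    using adjacent_arcs_not_both_nonempty[of d "a + int n" "c + int n" "b + int n"] order f' e''
    by auto
  ultimately show ?thesis by linarith
qed

text \<open>
  An uncrossed diagonal leaves each of its two sides only through its endpoints, so \<open>q a\<close> would have
  a neighbour on either side besides \<open>q b\<close>.
\<close>

lemma diagonal_is_crossed:
  assumes e: "{q a, q b} \<in> C" and ab: "a + 2 \<le> b" "b \<le> a + int n - 2"
  obtains c d where "a < c" "c < b" "b < d" "d < a + int n" "{q c, q d} \<in> C"
proof (rule ccontr)
  assume "\<not> thesis"
  then have none: "\<And>c d. a < c \<Longrightarrow> c < b \<Longrightarrow> b < d \<Longrightarrow> d < a + int n \<Longrightarrow> {q c, q d} \<notin> C"
    using that by blast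
  have side: "\<exists>x\<in>q ` {u<..<v}. {q a, x} \<in> C"
    if uv: "u = a \<and> v = b \<or> u = b \<and> v = a + int n" for u v
  proof -
    let ?T = "q ` {u<..<v}"
    have "q a \<notin> ?T" "q b \<notin> ?T"
      using q_inj[of a] q_inj[of b] q_inj[of "a + int n"] uv ab by fastforce+
    moreover have "u + 1 \<in> {u<..<v}" using uv ab by auto
    then have "?T \<noteq> {}" by blast
    moreover have "y = q a \<or> y = q b" if xy: "x \<in> ?T" "y \<in> P - ?T" "{x, y} \<in> C" for x y
    proof (rule ccontr)
      assume no: "\<not> ?thesis"
      obtain c where c: "x = q c" "u < c" "c < v"
        using xy(1) by auto
      obtain w where w: "a \<le> w" "w < a + int n" "y = q w"
        using representative[of y a] xy(2) by auto
      have "w \<noteq> a" "w \<noteq> b" using no w by auto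
      moreover have "\<not> (u < w \<and> w < v)" using xy(2) w by auto
      ultimately show False
        using none[of c w] none[of w c] uv c w xy(3) by (auto simp: insert_commute)
    qed
    ultimately have "\<exists>x\<in>?T. \<exists>y\<in>?T. {q a, x} \<in> C \<and> {q b, y} \<in> C"
      using e by (intro hamiltonian_cycle_escape[OF ham, of ?T "q a" "q b" "q b" "q a"])
        (auto simp: insert_commute)
    then show ?thesis by blast
  qed
  obtain x where x: "a < x" "x < b" "{q a, q x} \<in> C" using side[of a b] by auto
  obtain y where y: "b < y" "y < a + int n" "{q a, q y} \<in> C" using side[of b "a + int n"] by auto
  have "q x = q y \<or> q x = q b \<or> q y = q b" using degree_le_2[OF x(3) y(3) e] .
  then show False using q_inj[of x y] q_inj[of x b] q_inj[of y b] x y ab by auto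
qed

text \<open>
  A crossing pair, seen from the \<open>m\<close> consecutive points \<open>q i, \<dots>, q (i + m - 1)\<close>: for \<open>n \<ge> 5\<close> its two
  edges are the only connection of these points to the rest of the cycle.
\<close>

definition gate :: "int \<Rightarrow> int \<Rightarrow> bool" where
  "gate i m \<longleftrightarrow> 2 \<le> m \<and> m \<le> int n - 2 \<and>
     {q i, q (i + m)} \<in> C \<and> {q (i - 1), q (i + m - 1)} \<in> C"

lemma gate_complement: "gate i m \<Longrightarrow> gate (i + m) (int n - m)"
  unfolding gate_def by (auto simp: insert_commute) (metis add_diff_eq diff_add_eq insert_commute q_add_n)

lemma diagonal_in_gate:
  assumes e: "{q a, q (a + k)} \<in> C" and k: "2 \<le> k" "k \<le> int n - 2"
  shows "gate a k \<or> gate (a + 1) k"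
proof -
  obtain c d where cd: "a < c" "c < a + k" "a + k < d" "d < a + int n" "{q c, q d} \<in> C"
    using diagonal_is_crossed[OF e] k by auto
  then consider "c = a + 1" "d = a + k + 1" | "c = a + k - 1" "d = a + int n - 1"
    using crossing_pair_parallel[OF cd(1-4) e cd(5)] by blast
  then show ?thesis
  proof cases
    case 1
    then show ?thesis using e k cd(5) by (simp add: gate_def add.commute add.left_commute)
  next
    case 2
    have "q (a + int n - 1) = q (a - 1)" using q_add_n[of "a - 1"] by (simp add: algebra_simps)
    then show ?thesis using 2 e k cd(5) by (simp add: gate_def insert_commute)
  qed
qed

text \<open>
  This polygon edge, which the gate cuts, would exhaust together with the gate the degrees of
  \<open>q i\<close> and \<open>q (i - 1)\<close>, so by the corner argument both sides of the gate have only two points.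
  The bow tie on four points is a genuine exception.
\<close>

lemma gate_hull_edge_absent:
  assumes g: "gate i m" and n: "5 \<le> n"
  shows "{q i, q (i - 1)} \<notin> C"
proof
  assume h: "{q i, q (i - 1)} \<in> C"
  have m: "2 \<le> m" "m \<le> int n - 2" and e: "{q i, q (i + m)} \<in> C"
    and f: "{q (i - 1), q (i + m - 1)} \<in> C" using g by (auto simp: gate_def)
  have qn: "q (i + int n - 1) = q (i - 1)" using q_add_n[of "i - 1"] by (simp add: algebra_simps)
  have f': "{q (i + m - 1), q (i + int n - 1)} \<in> C" unfolding qn using f by (simp add: insert_commute)
  show False
  proof (cases "m = 2")
    case False
    then obtain x where x: "i < x" "x < i + m - 1" "{q i, q x} \<in> C"
      using corner_arc[of i "i + m - 1" "i + m" "i + int n - 1"] m e f' by auto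
    have "q x = q (i - 1) \<or> q x = q (i + m) \<or> q (i - 1) = q (i + m)"
      using degree_le_2[OF x(3) h e] .
    then show False
      using q_inj[of x "i - 1"] q_inj[of x "i + m"] q_inj[of "i - 1" "i + m"] x m by auto
  next
    case True
    have e': "{q (i + m), q (i + int n)} \<in> C" using e by (simp add: insert_commute)
    have fn: "{q (i + int n - 1), q (i + m - 1 + int n)} \<in> C"
      unfolding qn q_add_n using f .
    obtain y where y: "i + m < y" "y < i + int n - 1" "{q (i - 1), q y} \<in> C"
      using corner_arc[of "i + m" "i + int n - 1" "i + int n" "i + m - 1 + int n"] m e' fn True n qn
      by auto
    have "q y = q i \<or> q y = q (i + m - 1) \<or> q i = q (i + m - 1)"
      using degree_le_2[OF y(3) _ f, of "q i"] h by (simp add: insert_commute)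
    then show False
      using q_inj[of y "i + int n"] q_inj[of y "i + m - 1"] q_inj[of i "i + m - 1"] y m by auto
  qed
qed

text \<open>
  An innermost gate: the cycle follows the boundary of the polygon all the way behind it.
\<close>

definition ear :: "int \<Rightarrow> int \<Rightarrow> bool" where
  "ear i m \<longleftrightarrow> gate i m \<and> (\<forall>x\<in>{i..<i + m - 1}. {q x, q (x + 1)} \<in> C)"

text \<open>
  Consider the cut around the first points \<open>q i, \<dots>, q x\<close> behind the gate. Two cycle edges pass it,
  and every one other than the gate edge at \<open>q i\<close> and the boundary edge from \<open>q x\<close> to \<open>q (x + 1)\<close>
  would be an inner diagonal, a polygon edge cut by the gate, or a second crossing of a gate edge.
\<close>

lemma gate_without_inner_diagonal_is_ear:
  assumes g: "gate i m" and n: "5 \<le> n"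
    and nodiag: "\<And>a b. i \<le> a \<Longrightarrow> a + 2 \<le> b \<Longrightarrow> b \<le> i + m - 1 \<Longrightarrow> {q a, q b} \<notin> C"
  shows "ear i m"
  unfolding ear_def
proof (intro conjI ballI g)
  fix x assume x: "x \<in> {i..<i + m - 1}"
  have m: "2 \<le> m" "m \<le> int n - 2" and e: "{q i, q (i + m)} \<in> C"
    and f: "{q (i - 1), q (i + m - 1)} \<in> C" using g by (auto simp: gate_def)
  have qn: "q (i + int n - 1) = q (i - 1)" using q_add_n[of "i - 1"] by (simp add: algebra_simps)
  have f': "{q (i + m - 1), q (i + int n - 1)} \<in> C" unfolding qn using f by (simp add: insert_commute)
  have ef: "crosses {q i, q (i + m)} {q (i + m - 1), q (i + int n - 1)}"
    using m by (intro crosses_if_interleaved) auto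
  have ef_ne: "{q i, q (i + m)} \<noteq> {q (i + m - 1), q (i + int n - 1)}"
    using q_inj[of i "i + m - 1"] q_inj[of i "i + int n - 1"] m by (auto simp: doubleton_eq_iff)
  let ?S = "q ` {i..x}"
  have S: "q i \<in> ?S" "q (x + 1) \<notin> ?S"
    using x m q_inj[of "x + 1"] by fastforce+
  have "?S \<subseteq> P" "?S \<noteq> {}" "?S \<noteq> P" using S q_in by auto
  then obtain u v u' v' where cut: "u \<in> ?S" "v \<in> P - ?S" "{u, v} \<in> C"
    "u' \<in> ?S" "v' \<in> P - ?S" "{u', v'} \<in> C" "{u, v} \<noteq> {u', v'}"
    by (rule hamiltonian_cycle_cut[OF ham])
  have leave: "{u, v} = {q i, q (i + m)} \<or> {u, v} = {q x, q (x + 1)}"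
    if uv: "u \<in> ?S" "v \<in> P - ?S" "{u, v} \<in> C" for u v
  proof -
    obtain y where y: "u = q y" "i \<le> y" "y \<le> x" using uv by auto
    obtain z where z: "i \<le> z" "z < i + int n" "v = q z"
      using representative[of v i] uv by auto
    have xz: "x < z" using uv z by force
    show ?thesis
    proof (cases "z \<le> i + m - 1")
      case True
      then have "z < y + 2" using nodiag[of y z] uv y z by auto
      then have "y = x" "z = x + 1" using y xz by auto
      then show ?thesis using y z by simp
    next
      case False
      have ne: "{u, v} \<noteq> {q (i + m - 1), q (i + int n - 1)}"
        using q_inj[of y "i + m - 1"] q_inj[of y "i + int n - 1"] y x m by (auto simp: doubleton_eq_iff)
      show ?thesis
      proof (cases "y = i")
        case True
        have "z \<noteq> i + int n - 1"
          using gate_hull_edge_absent[OF g n] uv y z True qn by auto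
        show ?thesis
        proof (cases "z = i + m")
          case False
          then have "crosses {q (i + m - 1), q (i + int n - 1)} {q z, q (i + int n)}"
            using \<open>\<not> z \<le> i + m - 1\<close> z \<open>z \<noteq> i + int n - 1\<close> m
            by (intro crosses_if_interleaved) auto
          then have "crosses {q (i + m - 1), q (i + int n - 1)} {u, v}"
            using True y z by (simp add: insert_commute)
          then show ?thesis
            using crossing_unique[OF f' e uv(3)] ef ef_ne ne crosses_sym by metis
        qed (use True y z in auto)
      next
        case False
        show ?thesis
        proof (cases "z = i + m")
          case True
          have "crosses {q y, q z} {q (i + m - 1), q (i + int n - 1)}"
            using True y x m by (intro crosses_if_interleaved) auto
          then have "crosses {q (i + m - 1), q (i + int n - 1)} {u, v}"
            using crosses_sym y z by simp
          then show ?thesis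
            using crossing_unique[OF f' e uv(3)] ef ef_ne ne crosses_sym by metis
        next
          case zm: False
          have "crosses {q i, q (i + m)} {u, v}"
            unfolding y z using False y x m z zm \<open>\<not> z \<le> i + m - 1\<close>
            by (intro crosses_if_interleaved) auto
          moreover have "{u, v} \<noteq> {q i, q (i + m)}"
            using q_inj[of y i] q_inj[of y "i + m"] False y x m by (auto simp: doubleton_eq_iff)
          ultimately show ?thesis
            using crossing_unique[OF e f' uv(3)] ef ef_ne ne by metis
        qed
      qed
    qed
  qed
  show "{q x, q (x + 1)} \<in> C"
    using leave[OF cut(1-3)] leave[OF cut(4-6)] cut(3,6,7) by metis
qed

text \<open>
  A diagonal behind the gate is part of a smaller gate, so a smallest gate is an ear.
\<close>

lemma gate_contains_ear:
  assumes "gate i m" and n: "5 \<le> n"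
  shows "\<exists>j k. ear j k \<and> i \<le> j \<and> j + k \<le> i + m"
  using assms(1)
proof (induction "nat m" arbitrary: i m rule: less_induct)
  case less
  show ?case
  proof (cases "\<exists>a b. i \<le> a \<and> a + 2 \<le> b \<and> b \<le> i + m - 1 \<and> {q a, q b} \<in> C")
    case False
    then have "ear i m" using gate_without_inner_diagonal_is_ear[OF less.prems n] by blast
    then show ?thesis by auto
  next
    case True
    then obtain a b where ab: "i \<le> a" "a + 2 \<le> b" "b \<le> i + m - 1" "{q a, q b} \<in> C" by blast
    \<comment> \<open>Whichever way the partner of this diagonal is shifted, the new gate stays behind the old one.\<close>
    define k where "k = b - a"
    have k: "2 \<le> k" "k \<le> int n - 2" "nat k < nat m" "a + k = b"
      using ab less.prems by (auto simp: k_def gate_def)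
    consider "gate a k" | "gate (a + 1) k"
      using diagonal_in_gate[of a k] ab k by auto
    then show ?thesis
    proof cases
      case 1
      then show ?thesis using less.hyps[OF k(3)] ab k by (smt (verit))
    next
      case 2
      then show ?thesis using less.hyps[OF k(3)] ab k by (smt (verit))
    qed
  qed
qed

text \<open>
  Every diagonal belongs to a gate, so without gates both cycle edges at a point are polygon edges.
\<close>

lemma hull_edges_or_gate: "(\<forall>x. {q x, q (x + 1)} \<in> C) \<or> (\<exists>i m. gate i m)"
proof (rule disjCI)
  assume nogate: "\<nexists>i m. gate i m"
  show "\<forall>x. {q x, q (x + 1)} \<in> C"
  proof
    fix x
    have short: "v = q (x + 1) \<or> v = q (x + int n - 1)" if xv: "{q x, v} \<in> C" for v
    proof -
      obtain y where y: "x \<le> y" "y < x + int n" "v = q y"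
        using representative[of v x] edge_subset[of "q x" v] xv by metis
      have "y \<noteq> x" using edge_subset[of "q x" v] xv y by auto
      moreover have "\<not> (2 \<le> y - x \<and> y - x \<le> int n - 2)"
        using diagonal_in_gate[of x "y - x"] nogate xv y by auto
      ultimately have "y = x + 1 \<or> y = x + int n - 1" using y by auto
      then show ?thesis using y by auto
    qed
    obtain y y' where "y \<noteq> y'" "{q x, y} \<in> C" "{q x, y'} \<in> C" by (rule two_neighbours)
    then show "{q x, q (x + 1)} \<in> C" using short by metis
  qed
qed

end

section \<open>Counting ears\<close>

context convex_polygon
begin

text \<open>
  Think of \<open>(q x, False)\<close> and \<open>(q x, True)\<close> as the first and second half of the polygon edge from
  \<open>q x\<close> to \<open>q (x + 1)\<close>. Every ear claims three halves. An ear with two points owns just one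
  polygon edge and takes also the first half of the next one. It is safe to do so: edge-disjoint
  two-point ears never sit on adjacent polygon edges, and a longer ear renounces the first half of
  its first edge.
\<close>

definition ear_tokens :: "int \<Rightarrow> int \<Rightarrow> (point \<times> bool) set" where
  "ear_tokens i m = (if m = 2 then {(q i, False), (q i, True), (q (i + 1), False)}
     else {(q i, True), (q (i + 1), False), (q (i + 1), True)})"

lemma card_ear_tokens: "card (ear_tokens i m) = 3"
proof -
  have "q i \<noteq> q (i + 1)" using q_inj[of i "i + 1"] n_ge_3 by auto
  then show ?thesis by (simp add: ear_tokens_def)
qed

text \<open>
  The hypotheses isolate what the claims depend on: the ears own different polygon edges, and
  two-point ears do not sit on adjacent ones.
\<close>

lemma ear_tokens_disjoint:
  assumes m: "2 \<le> m" "2 \<le> m'"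
    and hull: "\<And>x y. x \<in> {i..<i + m - 1} \<Longrightarrow> y \<in> {j..<j + m' - 1} \<Longrightarrow> q x \<noteq> q y"
    and two: "m = 2 \<Longrightarrow> m' = 2 \<Longrightarrow> q (i + 1) \<noteq> q j \<and> q (j + 1) \<noteq> q i"
  shows "ear_tokens i m \<inter> ear_tokens j m' = {}"
proof -
  have suc: "q (x + 1) \<noteq> q (y + 1)" if "q x \<noteq> q y" for x y
    using that by (metis add_diff_cancel_right' mod_diff_left_eq q_eq_iff)
  have ij: "q i \<noteq> q j" "q (i + 1) \<noteq> q (j + 1)" using hull[of i j] suc m by auto
  have "q (i + 1) \<noteq> q j" if "m \<noteq> 2" using hull[of "i + 1" j] that m by auto
  moreover have "q (j + 1) \<noteq> q i" if "m' \<noteq> 2" using hull[of i "j + 1"] that m by auto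
  ultimately show ?thesis using ij two unfolding ear_tokens_def by auto
qed

end

context one_plane_cycle
begin

text \<open>
  One ear on each side of a gate.
\<close>

lemma two_ears:
  assumes "gate i0 m0" "5 \<le> n"
  obtains i m j k where "ear i m" "ear j k" "i + m \<le> j" "j + k \<le> i + int n"
proof -
  obtain i m where im: "ear i m" "i0 \<le> i" "i + m \<le> i0 + m0"
    using gate_contains_ear[OF assms] by blast
  obtain j k where jk: "ear j k" "i0 + m0 \<le> j" "j + k \<le> i0 + int n"
    using gate_contains_ear[OF gate_complement[OF assms(1)] assms(2)] by fastforce
  show thesis using that[OF im(1) jk(1)] im jk by linarith
qed

end

text \<open>
  Two-point ears on adjacent polygon edges would share the chord that cuts off the common endpoint
  of these edges: it belongs to the gates of both.
\<close>

lemma disjoint_cycles_ear_tokens_disjoint: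
  assumes "one_plane_cycle P n q C" "one_plane_cycle P n q C'" "C \<inter> C' = {}"
    and e: "one_plane_cycle.ear n q C i m" and e': "one_plane_cycle.ear n q C' j m'"
  shows "convex_polygon.ear_tokens q i m \<inter> convex_polygon.ear_tokens q j m' = {}"
proof -
  interpret A: one_plane_cycle P n q C by fact
  interpret B: one_plane_cycle P n q C' by fact
  have shift: "q (x + s) = q (y + s)" if "q x = q y" for x y s
    using that by (metis A.q_eq_iff mod_add_left_eq)
  have A: "2 \<le> m" "\<And>x. x \<in> {i..<i + m - 1} \<Longrightarrow> {q x, q (x + 1)} \<in> C"
    "{q i, q (i + m)} \<in> C" "{q (i - 1), q (i + m - 1)} \<in> C"
    using e by (auto simp: A.ear_def A.gate_def)
  have B: "2 \<le> m'" "\<And>x. x \<in> {j..<j + m' - 1} \<Longrightarrow> {q x, q (x + 1)} \<in> C'"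
    "{q j, q (j + m')} \<in> C'" "{q (j - 1), q (j + m' - 1)} \<in> C'"
    using e' by (auto simp: B.ear_def B.gate_def)
  show ?thesis
  proof (rule A.ear_tokens_disjoint)
    show "2 \<le> m" "2 \<le> m'" by fact+
    show "q x \<noteq> q y" if "x \<in> {i..<i + m - 1}" "y \<in> {j..<j + m' - 1}" for x y
      using A(2)[OF that(1)] B(2)[OF that(2)] shift[of x y 1] assms(3) by auto
    show "q (i + 1) \<noteq> q j \<and> q (j + 1) \<noteq> q i" if "m = 2" "m' = 2"
    proof
      show "q (i + 1) \<noteq> q j"
      proof
        assume eq: "q (i + 1) = q j"
        \<comment> \<open>The shared chord joins \<open>q i\<close> and \<open>q (i + 2)\<close>.\<close>
        have "q (j - 1) = q i" "q (j + 1) = q (i + 2)"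
          using shift[OF eq, of "-1"] shift[OF eq, of 1] by (simp_all add: ac_simps)
        moreover have "{q (j - 1), q (j + 1)} \<in> C'" using B(4) that by (simp add: ac_simps)
        ultimately show False using A(3) assms(3) that by auto
      qed
      show "q (j + 1) \<noteq> q i"
      proof
        assume eq: "q (j + 1) = q i"
        \<comment> \<open>The shared chord joins \<open>q j\<close> and \<open>q (j + 2)\<close>.\<close>
        have "q (i - 1) = q j" "q (i + 1) = q (j + 2)"
          using shift[OF eq, of "-1"] shift[OF eq, of 1] by (simp_all add: ac_simps)
        moreover have "{q (i - 1), q (i + 1)} \<in> C" using A(4) that by (simp add: ac_simps)
        ultimately show False using B(3) assms(3) that by auto
      qed
    qed
  qed
qed

lemma (in one_plane_cycle) hull_edge_exists:
  assumes n: "5 \<le> n"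
  shows "\<exists>x. {q x, q (x + 1)} \<in> C"
proof -
  have "\<exists>x. {q x, q (x + 1)} \<in> C" if g: "gate i m" for i m
  proof -
    obtain j k where "ear j k" using gate_contains_ear[OF g n] by blast
    then have "{q j, q (j + 1)} \<in> C" by (auto simp: ear_def gate_def)
    then show ?thesis by blast
  qed
  then show ?thesis using hull_edges_or_gate by blast
qed

text \<open>
  A vertex has four different neighbours in two disjoint cycles.
\<close>

lemma (in convex_polygon) disjoint_cycles_need_five_points:
  assumes "one_PHC P C" "one_PHC P C'" "C \<inter> C' = {}"
  shows "5 \<le> n"
proof -
  interpret A: one_plane_cycle P n q C by unfold_locales fact
  interpret B: one_plane_cycle P n q C' by unfold_locales fact
  obtain x y where A: "x \<noteq> y" "{q 0, x} \<in> C" "{q 0, y} \<in> C" by (rule A.two_neighbours)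
  obtain x' y' where B: "x' \<noteq> y'" "{q 0, x'} \<in> C'" "{q 0, y'} \<in> C'" by (rule B.two_neighbours)
  have "x \<noteq> x'" "x \<noteq> y'" "y \<noteq> x'" "y \<noteq> y'" using A B assms(3) by blast+
  then have "card {q 0, x, y, x', y'} = 5"
    using A B assms(3) A.edge_subset[OF A(2)] A.edge_subset[OF A(3)] B.edge_subset[OF B(2)]
      B.edge_subset[OF B(3)] by auto
  moreover have "{q 0, x, y, x', y'} \<subseteq> P"
    using A.edge_subset[OF A(2)] A.edge_subset[OF A(3)] B.edge_subset[OF B(2)]
      B.edge_subset[OF B(3)] by auto
  ultimately show ?thesis using card_mono[OF finite_P, of "{q 0, x, y, x', y'}"] card_P by linarith
qed

text \<open>
  If there are two cycles, then no cycle is the polygon itself, because every cycle contains a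
  polygon edge. So each cycle has two ears, which claim six of the \<open>2 n\<close> half edges.
\<close>

lemma (in convex_polygon) packing_bound:
  assumes F: "one_PHC_packing P F"
  shows "finite F \<and> card F \<le> n div 3"
proof -
  have PHC: "one_PHC P C" if "C \<in> F" for C
    using that F by (simp add: one_PHC_packing_def)
  have disj: "C \<inter> C' = {}" if "C \<in> F" "C' \<in> F" "C \<noteq> C'" for C C'
    using that F by (auto simp: one_PHC_packing_def disjoint_def)
  have "F \<subseteq> Pow (Pow P)"
    using PHC unfolding one_PHC_def hamiltonian_cycle_def complete_edges_def by blast
  then have finF: "finite F" using finite_P finite_subset by blast
  show ?thesis
  proof (cases "\<exists>C\<in>F. \<exists>C'\<in>F. C \<noteq> C'")
    case False
    then have "card F \<le> 1" using finF by (auto simp: card_le_Suc0_iff_eq)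
    then show ?thesis using finF n_ge_3 by auto
  next
    case True
    then have n5: "5 \<le> n" using disjoint_cycles_need_five_points PHC disj by metis
    have loc: "one_plane_cycle P n q C" if "C \<in> F" for C
      by unfold_locales (rule PHC[OF that])
    have "\<exists>T. card T = 6 \<and> (\<forall>t\<in>T. \<exists>i m. one_plane_cycle.ear n q C i m \<and> t \<in> ear_tokens i m)"
      if C: "C \<in> F" for C
    proof -
      interpret A: one_plane_cycle P n q C by (rule loc[OF C])
      obtain C' where C': "C' \<in> F" "C' \<noteq> C" using True C by metis
      obtain x where "{q x, q (x + 1)} \<in> C'"
        using one_plane_cycle.hull_edge_exists[OF loc[OF C'(1)] n5] by blast
      then have "{q x, q (x + 1)} \<notin> C" using disj[OF C'(1) C C'(2)] by blast
      then obtain i0 m0 where "A.gate i0 m0" using A.hull_edges_or_gate by blast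
      then obtain i m j k where ears: "A.ear i m" "A.ear j k" "i + m \<le> j" "j + k \<le> i + int n"
        using A.two_ears n5 by metis
      have m: "2 \<le> m" "2 \<le> k" using ears by (auto simp: A.ear_def A.gate_def)
      have sep: "q x \<noteq> q y" if "i \<le> x" "x < i + m" "j \<le> y" "y < j + k" for x y
        using q_inj[of x y] that ears by auto
      have fin: "finite (ear_tokens i m)" for i m by (simp add: ear_tokens_def)
      have "q (i + 1) \<noteq> q j" "q i \<noteq> q (j + 1)" by (rule sep; use m in simp)+
      then have "ear_tokens i m \<inter> ear_tokens j k = {}"
        using m by (intro ear_tokens_disjoint) (auto simp: sep dest: sym)
      then have "card (ear_tokens i m \<union> ear_tokens j k) = 6"
        by (simp add: card_Un_disjoint card_ear_tokens fin)
      then show ?thesis using ears by blast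
    qed
    then obtain T where T: "\<And>C. C \<in> F \<Longrightarrow> card (T C) = 6"
      "\<And>C t. C \<in> F \<Longrightarrow> t \<in> T C \<Longrightarrow> \<exists>i m. one_plane_cycle.ear n q C i m \<and> t \<in> ear_tokens i m"
      by metis
    have "6 * card F = card (\<Union>C\<in>F. T C)"
    proof (subst card_UN_disjoint[OF finF])
      show "\<forall>C\<in>F. finite (T C)" using T(1) by (metis card.infinite zero_neq_numeral)
      show "\<forall>C\<in>F. \<forall>C'\<in>F. C \<noteq> C' \<longrightarrow> T C \<inter> T C' = {}"
      proof (intro ballI impI Int_emptyI)
        fix C C' t assume C: "C \<in> F" "C' \<in> F" "C \<noteq> C'" and t: "t \<in> T C" "t \<in> T C'"
        obtain i m where "one_plane_cycle.ear n q C i m" "t \<in> ear_tokens i m"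
          using T(2) C(1) t(1) by blast
        moreover obtain j k where "one_plane_cycle.ear n q C' j k" "t \<in> ear_tokens j k"
          using T(2) C(2) t(2) by blast
        ultimately show False
          using disjoint_cycles_ear_tokens_disjoint[OF loc[OF C(1)] loc[OF C(2)] disj[OF C]]
          by blast
      qed
    qed (simp add: T(1))
    also have "\<dots> \<le> card (P \<times> (UNIV :: bool set))"
    proof (rule card_mono)
      show "finite (P \<times> (UNIV :: bool set))" using finite_P by simp
      have "ear_tokens i m \<subseteq> P \<times> UNIV" for i m by (auto simp: ear_tokens_def)
      then show "(\<Union>C\<in>F. T C) \<subseteq> P \<times> UNIV" using T(2) by blast
    qed
    also have "\<dots> = 2 * n" by (simp add: card_cartesian_product card_P)
    finally show ?thesis using finF by auto
  qed
qed

section \<open>Zigzag cycles\<close>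

fun path_edges :: "'a list \<Rightarrow> 'a set set" where
  "path_edges (x # y # zs) = insert {x, y} (path_edges (y # zs))"
| "path_edges _ = {}"

lemma path_edges_Cons: "ys \<noteq> [] \<Longrightarrow> path_edges (x # ys) = insert {x, hd ys} (path_edges ys)"
  by (cases ys) auto

lemma path_edges_snoc: "ys \<noteq> [] \<Longrightarrow> path_edges (ys @ [z]) = insert {last ys, z} (path_edges ys)"
  by (induction ys rule: path_edges.induct) auto

lemma path_edges_rev: "path_edges (rev ys) = path_edges ys"
proof (induction ys)
  case (Cons x ys)
  then show ?case
    by (cases "ys = []") (auto simp: path_edges_Cons path_edges_snoc last_rev insert_commute)
qed simp

lemma path_edges_map: "path_edges (map f ys) = (`) f ` path_edges ys"
  by (induction ys rule: path_edges.induct) auto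

lemma path_edges_nth: "path_edges ys = {{ys ! i, ys ! Suc i} | i. Suc i < length ys}"
proof (induction ys rule: path_edges.induct)
  case (1 x y zs)
  have "{{(x # y # zs) ! i, (x # y # zs) ! Suc i} | i. Suc i < length (x # y # zs)}
      = insert {x, y} {{(y # zs) ! i, (y # zs) ! Suc i} | i. Suc i < length (y # zs)}"
    (is "?A = ?B")
  proof
    show "?A \<subseteq> ?B"
    proof
      fix e assume "e \<in> ?A"
      then obtain i where i: "Suc i < length (x # y # zs)"
        "e = {(x # y # zs) ! i, (x # y # zs) ! Suc i}" by blast
      then show "e \<in> ?B" by (cases i) auto
    qed
    show "?B \<subseteq> ?A"
    proof
      fix e assume "e \<in> ?B"
      then consider "e = {x, y}"
        | i where "Suc i < length (y # zs)" "e = {(y # zs) ! i, (y # zs) ! Suc i}" by blast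
      then show "e \<in> ?A"
      proof cases
        case 1
        then show ?thesis by (intro CollectI exI[of _ 0]) simp
      next
        case (2 i)
        then show ?thesis by (intro CollectI exI[of _ "Suc i"]) simp
      qed
    qed
  qed
  then show ?case using 1 by simp
qed auto

lemma cycle_edges_path_edges:
  assumes "xs \<noteq> []"
  shows "cycle_edges xs = insert {last xs, hd xs} (path_edges xs)"
proof -
  define N where "N = length xs"
  have N: "N > 0" using assms by (simp add: N_def)
  have indices: "{..<N} = insert (N - 1) {i. Suc i < N}" using N by auto
  have "cycle_edges xs = (\<lambda>i. {xs ! i, xs ! (Suc i mod N)}) ` {..<N}"
    unfolding cycle_edges_def N_def by blast
  also have "\<dots> = (\<lambda>i. {xs ! i, xs ! (Suc i mod N)}) ` insert (N - 1) {i. Suc i < N}"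
    by (simp only: indices)
  also have "\<dots> = insert {xs ! (N - 1), xs ! 0} ((\<lambda>i. {xs ! i, xs ! Suc i}) ` {i. Suc i < N})"
    using N by auto
  also have "\<dots> = insert {last xs, hd xs} (path_edges xs)"
    unfolding path_edges_nth using assms by (auto simp: N_def last_conv_nth hd_conv_nth)
  finally show ?thesis .
qed

text \<open>
  A Hamiltonian path on \<open>m\<close> consecutive indices from the first to the last one. The reversal makes the
  two new edges cross: the new first index is joined to the old last one and conversely.
\<close>

fun zigzag :: "int \<Rightarrow> nat \<Rightarrow> int list" where
  "zigzag l 0 = []"
| "zigzag l (Suc 0) = [l]"
| "zigzag l (Suc (Suc m)) = l # rev (zigzag (l + 1) m) @ [l + int m + 1]"

lemma set_zigzag: "set (zigzag l m) = {l..<l + int m}"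
proof (induction l m rule: zigzag.induct)
  case (3 l m)
  have "{l..<l + int (Suc (Suc m))} = insert l (insert (l + int m + 1) {l + 1..<l + 1 + int m})"
    by auto
  then show ?case using 3 by simp
qed auto

lemma length_zigzag: "length (zigzag l m) = m"
  by (induction l m rule: zigzag.induct) auto

lemma distinct_zigzag: "distinct (zigzag l m)"
  by (induction l m rule: zigzag.induct) (auto simp: set_zigzag)

lemma zigzag_nonempty: "0 < m \<Longrightarrow> zigzag l m \<noteq> []"
  using length_zigzag[of l m] by auto

lemma hd_zigzag: "0 < m \<Longrightarrow> hd (zigzag l m) = l"
  by (induction l m rule: zigzag.induct) auto

lemma last_zigzag: "0 < m \<Longrightarrow> last (zigzag l m) = l + int m - 1"
  by (induction l m rule: zigzag.induct) auto

lemma path_edges_zigzag_step: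
  assumes "0 < m"
  shows "path_edges (zigzag l (Suc (Suc m)))
    = {{l, l + int m}, {l + 1, l + int m + 1}} \<union> path_edges (zigzag (l + 1) m)"
  using assms zigzag_nonempty[OF assms, of "l + 1"]
  by (simp add: path_edges_Cons path_edges_snoc path_edges_rev hd_append hd_rev last_rev
      hd_zigzag last_zigzag insert_commute)

text \<open>
  In a regular polygon the sum of its two indices determines the direction of a chord. All edges of
  the path are nearly perpendicular to its axis of symmetry, and this is how cycles with different
  axes will be seen to be disjoint.
\<close>

lemma zigzag_edge_sum:
  assumes "e \<in> path_edges (zigzag l m)"
  shows "\<exists>x y. e = {x, y} \<and> l \<le> x \<and> x < y \<and> y < l + int m \<and> \<bar>x + y - (2 * l + int m - 1)\<bar> \<le> 1"
  using assms
proof (induction l m rule: zigzag.induct)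
  case (3 l m)
  show ?case
  proof (cases "m = 0")
    case True
    then show ?thesis using 3 by (intro exI[of _ l] exI[of _ "l + 1"]) auto
  next
    case False
    then consider "e = {l, l + int m}" | "e = {l + 1, l + int m + 1}"
      | "e \<in> path_edges (zigzag (l + 1) m)"
      using 3(2) path_edges_zigzag_step[of m l] by auto
    then show ?thesis
    proof cases
      case 1
      then show ?thesis using False by (intro exI[of _ l] exI[of _ "l + int m"]) auto
    next
      case 2
      then show ?thesis using False by (intro exI[of _ "l + 1"] exI[of _ "l + int m + 1"]) auto
    next
      case 3
      then obtain x y where "e = {x, y}" "l + 1 \<le> x" "x < y" "y < l + 1 + int m"
        "\<bar>x + y - (2 * (l + 1) + int m - 1)\<bar> \<le> 1" using "3.IH" by blast
      then show ?thesis by (intro exI[of _ x] exI[of _ y]) auto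
    qed
  qed
qed auto

lemma one_plane_add_pair:
  assumes "one_plane E"
    and "\<And>f. f \<in> E \<Longrightarrow> f \<noteq> g \<Longrightarrow> \<not> crosses g f"
    and "\<And>f. f \<in> E \<Longrightarrow> f \<noteq> h \<Longrightarrow> \<not> crosses h f"
  shows "one_plane (insert g (insert h E))"
  unfolding one_plane_def
proof
  fix e assume e: "e \<in> insert g (insert h E)"
  show "\<exists>\<^sub>\<le>\<^sub>1f. f \<in> insert g (insert h E) \<and> f \<noteq> e \<and> crosses e f"
  proof (cases "e \<in> E")
    case True
    have inE: "f \<in> E" if "f \<in> insert g (insert h E)" "f \<noteq> e" "crosses e f" for f
      using that assms(2,3)[OF True] crosses_sym[of e f] by auto
    have "\<exists>\<^sub>\<le>\<^sub>1f. f \<in> E \<and> f \<noteq> e \<and> crosses e f"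
      using assms(1) True by (simp add: one_plane_def)
    then show ?thesis
      unfolding Uniq_def using inE by meson
  next
    case False
    then have "f \<in> {g, h} - {e}" if "f \<in> insert g (insert h E)" "f \<noteq> e" "crosses e f" for f
      using that e assms(2,3)[of f] by auto
    moreover have "e = g \<or> e = h" using e False by simp
    ultimately show ?thesis
      by (intro Uniq_I) blast
  qed
qed

context convex_polygon
begin

text \<open>
  Each step adds a pair of chords whose inner sides contain all earlier edges, so they cross nothing
  but each other.
\<close>

lemma one_plane_zigzag: "m \<le> n \<Longrightarrow> one_plane ((`) q ` path_edges (zigzag l m))"
proof (induction l m rule: zigzag.induct)
  case (3 l m)
  show ?case
  proof (cases "m = 0")
    case True
    then show ?thesis by (simp add: one_plane_def Uniq_def)
  next
    case False
    have inner: "\<not> crosses {q a, q b} f"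
      if ab: "f \<in> (`) q ` path_edges (zigzag (l + 1) m)" "a \<le> l + 1" "l + int m \<le> b"
        "a < l + 1 \<or> l + int m < b" "a < b" "b < a + int n" for a b f
    proof -
      obtain e where e: "f = q ` e" "e \<in> path_edges (zigzag (l + 1) m)" using ab(1) by blast
      then obtain x y where xy: "f = {q x, q y}" "l + 1 \<le> x" "x < y" "y < l + 1 + int m"
        using zigzag_edge_sum[OF e(2)] by auto
      show ?thesis unfolding xy(1) using ab xy by (intro not_crosses_if_nested) auto
    qed
    have "one_plane (insert {q l, q (l + int m)} (insert {q (l + 1), q (l + int m + 1)}
      ((`) q ` path_edges (zigzag (l + 1) m))))"
      using 3 False by (intro one_plane_add_pair inner) auto
    then show ?thesis using False path_edges_zigzag_step[of m l] by simp
  qed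
qed (simp_all add: one_plane_def)

text \<open>
  All other points lie on one side of a polygon edge.
\<close>

lemma hull_edge_not_crossed:
  assumes "f \<subseteq> P" "card f = 2" "f \<noteq> {q x, q (x + 1)}"
  shows "\<not> crosses {q x, q (x + 1)} f"
proof -
  obtain u v where f: "f = {u, v}" "u \<noteq> v" using assms(2) by (meson card_2_iff)
  obtain c where c: "x + 1 \<le> c" "c < x + 1 + int n" "u = q c"
    using representative[of u "x + 1"] f assms(1) by auto
  obtain d where d: "x + 1 \<le> d" "d < x + 1 + int n" "v = q d"
    using representative[of v "x + 1"] f assms(1) by auto
  have main: "\<not> crosses {q (x + 1), q (x + int n)} {q c, q d}"
    if "x + 1 \<le> c" "c < d" "d \<le> x + int n" "{q c, q d} = f" for c d
  proof (rule not_crosses_if_nested)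
    show "x + 1 < c \<or> d < x + int n"
      using that assms(3) by (force simp: insert_commute)
  qed (use that n_ge_3 in auto)
  have "c \<noteq> d" using f c d by auto
  then show ?thesis
    using main[of c d] main[of d c] c d f by (cases "c < d") (auto simp: insert_commute)
qed

lemma one_plane_add_hull_edge:
  assumes "one_plane E" "E \<subseteq> complete_edges P"
  shows "one_plane (insert {q x, q (x + 1)} E)"
  using one_plane_add_pair[OF assms(1), of "{q x, q (x + 1)}" "{q x, q (x + 1)}"]
    hull_edge_not_crossed assms(2) by (auto simp: complete_edges_def)

lemma cycle_edges_complete:
  assumes "distinct xs" "2 \<le> length xs" "set xs \<subseteq> P"
  shows "cycle_edges xs \<subseteq> complete_edges P"
proof
  fix e assume "e \<in> cycle_edges xs"
  then obtain i where i: "i < length xs" "e = {xs ! i, xs ! (Suc i mod length xs)}"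
    by (auto simp: cycle_edges_def)
  have "Suc i mod length xs \<noteq> i" "Suc i mod length xs < length xs"
    using assms(2) i(1) by (auto simp: mod_Suc)
  then show "e \<in> complete_edges P"
    using assms i by (auto simp: complete_edges_def nth_eq_iff_index_eq card_insert_if)
qed

lemma one_PHC_of_enumeration:
  assumes xs: "distinct (map q xs)" "length xs = n" "one_plane (cycle_edges (map q xs))"
  shows "one_PHC P (cycle_edges (map q xs))"
proof -
  have "set (map q xs) = P"
    using distinct_card[OF xs(1)] xs(2) card_P by (intro card_subset_eq finite_P) auto
  then show ?thesis
    using xs n_ge_3 cycle_edges_complete[OF xs(1)]
    unfolding one_PHC_def hamiltonian_cycle_def by auto
qed

lemma distinct_map_q:
  assumes "distinct xs" "set xs \<subseteq> {l..<l + int n}"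
  shows "distinct (map q xs)"
proof -
  have "inj_on q (set xs)"
  proof (rule inj_onI)
    fix x y assume xy: "x \<in> set xs" "y \<in> set xs" "q x = q y"
    then have "l \<le> x" "x < l + int n" "l \<le> y" "y < l + int n" using assms(2) by auto
    then show "x = y" using q_inj[OF xy(3)] by linarith
  qed
  then show ?thesis using assms(1) by (simp add: distinct_map)
qed

text \<open>
  The cycle consists of all chords whose index sum is \<open>s - 1\<close> or \<open>s + 1\<close> modulo \<open>n\<close>, closed up by
  polygon edges where the axis of symmetry leaves the polygon. The parity of \<open>s\<close> decides whether the
  axis starts at the midpoint of a polygon edge, which closes the zigzag path through all points, or
  at a point \<open>q w\<close>, which is joined to both ends of a zigzag path through the other points.
\<close>

lemma zigzag_cycle_exists:
  "\<exists>C. one_PHC P C \<and> (\<forall>e\<in>C. \<exists>x y k. e = {q x, q y} \<and> \<bar>x + y + k * int n - s\<bar> \<le> 1)"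
proof (cases "even s")
  case False
  define l where "l = (s + 1) div 2"
  have s: "s = 2 * l - 1" using False by (auto simp: l_def elim!: oddE)
  let ?xs = "zigzag l n"
  have hd_last: "hd ?xs = l" "last ?xs = l + int n - 1" "?xs \<noteq> []"
    using n_ge_3 by (simp_all add: hd_zigzag last_zigzag zigzag_nonempty)
  have dist: "distinct (map q ?xs)"
    by (rule distinct_map_q[of _ l]) (simp_all add: distinct_zigzag set_zigzag)
  have "q (l - 1 + int n) = q (l - 1)" by (rule q_add_n)
  then have qn: "q (l + int n - 1) = q (l - 1)" by (simp add: algebra_simps)
  have edges: "cycle_edges (map q ?xs) = insert {q (l - 1), q (l - 1 + 1)} ((`) q ` path_edges ?xs)"
    using hd_last qn by (simp add: cycle_edges_path_edges path_edges_map last_map hd_map)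
  have "cycle_edges (map q ?xs) \<subseteq> complete_edges P"
    using dist n_ge_3 by (intro cycle_edges_complete) (auto simp: length_zigzag)
  then have "one_plane (cycle_edges (map q ?xs))"
    unfolding edges by (intro one_plane_add_hull_edge one_plane_zigzag) auto
  then have "one_PHC P (cycle_edges (map q ?xs))"
    using dist by (intro one_PHC_of_enumeration) (simp_all add: length_zigzag)
  moreover have "\<exists>x y k. e = {q x, q y} \<and> \<bar>x + y + k * int n - s\<bar> \<le> 1"
    if e: "e \<in> cycle_edges (map q ?xs)" for e
  proof (cases "e = {q (l - 1), q l}")
    case True
    then show ?thesis using s by (intro exI[of _ "l - 1"] exI[of _ l] exI[of _ 0]) simp
  next
    case False
    then obtain d where d: "e = q ` d" "d \<in> path_edges ?xs" using e unfolding edges by auto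
    then obtain x y where "e = {q x, q y}" "\<bar>x + y - (2 * l + int n - 1)\<bar> \<le> 1"
      using zigzag_edge_sum[OF d(2)] by auto
    then show ?thesis using s by (intro exI[of _ x] exI[of _ y] exI[of _ "-1"]) simp
  qed
  ultimately show ?thesis by blast
next
  case True
  define w where "w = s div 2"
  have s: "s = 2 * w" using True by (simp add: w_def)
  let ?zs = "zigzag (w + 1) (n - 1)"
  let ?xs = "w # ?zs"
  have n1: "int (n - 1) = int n - 1" "0 < n - 1" using n_ge_3 by auto
  have hd_last: "hd ?zs = w + 1" "last ?zs = w + int n - 1" "?zs \<noteq> []"
    using n1 by (simp_all add: hd_zigzag last_zigzag zigzag_nonempty)
  have dist: "distinct (map q ?xs)"
    by (rule distinct_map_q[of _ w]) (use n1 in \<open>auto simp: distinct_zigzag set_zigzag\<close>)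
  have "q (w - 1 + int n) = q (w - 1)" by (rule q_add_n)
  then have qn: "q (w + int n - 1) = q (w - 1)" by (simp add: algebra_simps)
  have edges: "cycle_edges (map q ?xs)
      = insert {q (w - 1), q (w - 1 + 1)} (insert {q w, q (w + 1)} ((`) q ` path_edges ?zs))"
    using hd_last qn
    by (simp add: cycle_edges_path_edges path_edges_Cons path_edges_map last_map hd_map)
  have len: "length ?xs = n" using n1 by (simp add: length_zigzag)
  have "cycle_edges (map q ?xs) \<subseteq> complete_edges P"
    using dist n_ge_3 len by (intro cycle_edges_complete) auto
  then have "one_plane (cycle_edges (map q ?xs))"
    unfolding edges by (intro one_plane_add_hull_edge one_plane_zigzag) auto
  then have "one_PHC P (cycle_edges (map q ?xs))"
    using dist len by (intro one_PHC_of_enumeration)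
  moreover have "\<exists>x y k. e = {q x, q y} \<and> \<bar>x + y + k * int n - s\<bar> \<le> 1"
    if e: "e \<in> cycle_edges (map q ?xs)" for e
  proof -
    consider "e = {q (w - 1), q w}" | "e = {q w, q (w + 1)}"
      | d where "e = q ` d" "d \<in> path_edges ?zs"
      using e unfolding edges by auto
    then show ?thesis
    proof cases
      case 1
      then show ?thesis using s by (intro exI[of _ "w - 1"] exI[of _ w] exI[of _ 0]) simp
    next
      case 2
      then show ?thesis using s by (intro exI[of _ w] exI[of _ "w + 1"] exI[of _ 0]) simp
    next
      case 3
      then obtain x y where "e = {q x, q y}" "\<bar>x + y - (2 * (w + 1) + int (n - 1) - 1)\<bar> \<le> 1"
        using zigzag_edge_sum[OF 3(2)] by auto
      then show ?thesis using s n1 by (intro exI[of _ x] exI[of _ y] exI[of _ "-1"]) simp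
    qed
  qed
  ultimately show ?thesis by blast
qed

text \<open>
  The sums occurring in the cycle with centre \<open>3 t\<close> are \<open>3 t - 1\<close>, \<open>3 t\<close> and \<open>3 t + 1\<close> modulo \<open>n\<close>. For
  different \<open>t < n div 3\<close> these triples of residues are disjoint, and an edge determines the residue
  of its sum.
\<close>

lemma packing_exists: "\<exists>F. one_PHC_packing P F \<and> finite F \<and> card F = n div 3"
proof -
  obtain Z where Z: "\<And>s. one_PHC P (Z s)"
    "\<And>s e. e \<in> Z s \<Longrightarrow> \<exists>x y k. e = {q x, q y} \<and> \<bar>x + y + k * int n - s\<bar> \<le> 1"
    using zigzag_cycle_exists by metis
  have disj: "Z s \<inter> Z s' = {}" if far: "3 \<le> s' - s" "s' - s \<le> int n - 3" for s s'
  proof (rule ccontr)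
    assume "Z s \<inter> Z s' \<noteq> {}"
    then obtain e where e: "e \<in> Z s" "e \<in> Z s'" by blast
    obtain x y k where xy: "e = {q x, q y}" "\<bar>x + y + k * int n - s\<bar> \<le> 1" using Z(2)[OF e(1)] by blast
    obtain x' y' k' where xy': "e = {q x', q y'}" "\<bar>x' + y' + k' * int n - s'\<bar> \<le> 1"
      using Z(2)[OF e(2)] by blast
    have "(x + y) mod int n = (x' + y') mod int n"
    proof -
      consider "q x = q x'" "q y = q y'" | "q x = q y'" "q y = q x'"
        using xy(1) xy'(1) by (auto simp: doubleton_eq_iff)
      then show ?thesis
        by cases (metis q_eq_iff mod_add_cong, metis q_eq_iff mod_add_cong add.commute)
    qed
    then have "(x + y + k * int n) mod int n = (x' + y' + k' * int n) mod int n" by simp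
    then have "int n dvd (x' + y' + k' * int n) - (x + y + k * int n)"
      by (metis mod_eq_dvd_iff)
    then show False
      using xy(2) xy'(2) far
        dvd_imp_le_int[of "(x' + y' + k' * int n) - (x + y + k * int n)" "int n"] by linarith
  qed
  have pair: "Z (3 * int t) \<inter> Z (3 * int t') = {}" if "t < t'" "t' < n div 3" for t t'
    using that by (intro disj) auto
  define F where "F = (\<lambda>t. Z (3 * int t)) ` {..<n div 3}"
  have nonempty: "Z s \<noteq> {}" for s
  proof -
    obtain xs where "3 \<le> length xs" "Z s = cycle_edges xs"
      using Z(1)[of s] by (auto simp: one_PHC_def hamiltonian_cycle_def)
    then have "{xs ! 0, xs ! (Suc 0 mod length xs)} \<in> Z s" by (force simp: cycle_edges_def)
    then show ?thesis by blast
  qed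
  have "inj_on (\<lambda>t. Z (3 * int t)) {..<n div 3}"
  proof (rule linorder_inj_onI)
    fix t t' assume "t < t'" "t \<in> {..<n div 3}" "t' \<in> {..<n div 3}"
    then show "Z (3 * int t) \<noteq> Z (3 * int t')" using pair[of t t'] nonempty[of "3 * int t"] by auto
  qed auto
  then have "card F = n div 3" by (simp add: F_def card_image)
  moreover have "disjoint F"
    unfolding disjoint_def
  proof (intro ballI impI)
    fix A B assume "A \<in> F" "B \<in> F" "A \<noteq> B"
    then obtain t t' where t: "A = Z (3 * int t)" "B = Z (3 * int t')" "t < n div 3" "t' < n div 3"
      by (auto simp: F_def)
    then consider "t < t'" | "t' < t" using \<open>A \<noteq> B\<close> by (metis linorder_neqE_nat)
    then show "A \<inter> B = {}" using pair[of t t'] pair[of t' t] t by cases auto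
  qed
  then have "one_PHC_packing P F" using Z(1) by (auto simp: one_PHC_packing_def F_def)
  ultimately show ?thesis by (auto simp: F_def)
qed

end

theorem theorem1:
  fixes P :: "point set" and n :: nat
  assumes "finite P" and "card P = n" and "n \<ge> 3" and "convex_position P"
  shows "(\<forall>F. one_PHC_packing P F \<longrightarrow> finite F \<and> card F \<le> n div 3) \<and>
         (\<exists>F. one_PHC_packing P F \<and> finite F \<and> card F = n div 3)"
proof -
  obtain q where "convex_polygon P n q" using convex_polygon_exists[OF assms] .
  then interpret convex_polygon P n q .
  show ?thesis using packing_bound packing_exists by blast
qed

end
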